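(* Let $A$ be a finite-dimensional anti-commutative algebra over a field $F$ equipped with an action of a finite group $G$, and let $x\in A$ be a CB-element. Then $gx$ is also a CB-element for all $g\in G$.
   Context: An algebra over $F$ is a vector space with a bilinear product (not assumed associative), written by juxtaposition. It is anti-commutative if $x^2=0$ for all $x\in A$. For $x\in A$, $C_A(x)=\{y\in A\mid xy=0\}$. An element $z\in A$ is a CB-element if $(xz)y=0$ for all $x\in A$ and all $y\in C_A(x)$. An action of $G$ on $A$ is a map $G\times A\to A$, $(g,x)\mapsto gx$, such that: for each $g$ the map $x\mapsto gx$ is linear; $ex=x$ for all $x\in A$, where $e$ is the identity of $G$; $g_1(g_2x)=(g_1g_2)x$ for all $g_1,g_2\in G$, $x\in A$; and $g(xy)=(gx)(gy)$ for all $g\in G$, $x,y\in A$. *)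

theory Defs
  imports Complex_Main "HOL-Algebra.Group"
begin

(* The algebra is carried by a whole type 'a, with scalars in 'f; scale is its scalar
   multiplication and amult its product.  The bare name linear means real-linear, hence the
   qualified Vector_Spaces.linear. *)

locale nonassoc_algebra = vector_space scale
  for scale :: "'f::field \<Rightarrow> 'a::ab_group_add \<Rightarrow> 'a" +
  fixes amult :: "'a \<Rightarrow> 'a \<Rightarrow> 'a"
  assumes linear_mult_left: "Vector_Spaces.linear scale scale (\<lambda>x. amult x y)"
    and linear_mult_right: "Vector_Spaces.linear scale scale (\<lambda>y. amult x y)"

(* The library locale carries a chosen basis as a parameter; only its existence matters here. *)

definition finite_dimensional :: "('f::field \<Rightarrow> 'a::ab_group_add \<Rightarrow> 'a) \<Rightarrow> bool" where
  "finite_dimensional scale \<longleftrightarrow> (\<exists>Basis. finite_dimensional_vector_space scale Basis)"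

definition anticommutative :: "('a::zero \<Rightarrow> 'a \<Rightarrow> 'a) \<Rightarrow> bool" where
  "anticommutative amult \<longleftrightarrow> (\<forall>x. amult x x = 0)"

definition centralizer :: "('a::zero \<Rightarrow> 'a \<Rightarrow> 'a) \<Rightarrow> 'a \<Rightarrow> 'a set" where
  "centralizer amult x = {y. amult x y = 0}"

definition CB_element :: "('a::zero \<Rightarrow> 'a \<Rightarrow> 'a) \<Rightarrow> 'a \<Rightarrow> bool" where
  "CB_element amult z \<longleftrightarrow> (\<forall>x. \<forall>y \<in> centralizer amult x. amult (amult x z) y = 0)"

locale algebra_action = nonassoc_algebra scale amult + group G
  for scale :: "'f::field \<Rightarrow> 'a::ab_group_add \<Rightarrow> 'a"
    and amult :: "'a \<Rightarrow> 'a \<Rightarrow> 'a"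
    and G :: "('g, 'm) monoid_scheme" (structure) +
  fixes act :: "'g \<Rightarrow> 'a \<Rightarrow> 'a"
  assumes act_linear: "g \<in> carrier G \<Longrightarrow> Vector_Spaces.linear scale scale (act g)"
    and act_one: "act \<one> x = x"
    and act_act: "g\<^sub>1 \<in> carrier G \<Longrightarrow> g\<^sub>2 \<in> carrier G
      \<Longrightarrow> act g\<^sub>1 (act g\<^sub>2 x) = act (g\<^sub>1 \<otimes> g\<^sub>2) x"
    and act_mult: "g \<in> carrier G \<Longrightarrow> act g (amult x y) = amult (act g x) (act g y)"

end

theory Submission
  imports Defs
begin

text \<open>Each \<open>act g\<close> is an algebra automorphism with inverse
  \<open>act (inv g)\<close>, and being a CB-element is defined by the product alone, so
  automorphisms preserve it. Concretely, a pair with zero product is pulled back along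
  \<open>inv g\<close>, the condition on \<open>x\<close> is applied there, and the result is pushed
  forward by \<open>g\<close> (\<open>CB_element_act\<close>).\<close>

context algebra_action
begin

lemma act_zero: "g \<in> carrier G \<Longrightarrow> act g 0 = 0"
  by (rule module_hom.zero[OF Vector_Spaces.linear.axioms(3)[OF act_linear]])

lemma act_act_inv: "g \<in> carrier G \<Longrightarrow> act g (act (inv g) x) = x"
  by (simp add: act_act act_one)

lemma CB_element_act:
  assumes g: "g \<in> carrier G" and x: "CB_element amult x"
  shows "CB_element amult (act g x)"
  unfolding CB_element_def centralizer_def
proof (intro allI ballI, unfold mem_Collect_eq)
  fix u y
  assume "amult u y = 0"
  then have "amult (act (inv g) u) (act (inv g) y) = 0"
    \<comment> \<open>Read backwards, \<open>act_mult\<close> merges the two factors into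
      \<open>act (inv g) (amult u y)\<close>, the image of zero.\<close>
    using g by (simp flip: act_mult add: act_zero)
  then have "amult (amult (act (inv g) u) x) (act (inv g) y) = 0"
    using x by (simp add: CB_element_def centralizer_def)
  then have "act g (amult (amult (act (inv g) u) x) (act (inv g) y)) = 0"
    using g by (simp add: act_zero)
  \<comment> \<open>Distributing \<open>act g\<close> over both products cancels
    \<open>inv g\<close> on \<open>u\<close> and \<open>y\<close> and leaves \<open>act g\<close>
    only on \<open>x\<close>.\<close>
  then show "amult (amult u (act g x)) y = 0"
    using g by (simp add: act_mult act_act_inv)
qed

end

theorem theorem7p4:
  fixes scale :: "'f::field \<Rightarrow> 'a::ab_group_add \<Rightarrow> 'a"
    and amult :: "'a \<Rightarrow> 'a \<Rightarrow> 'a"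
    and G :: "('g, 'm) monoid_scheme"
    and act :: "'g \<Rightarrow> 'a \<Rightarrow> 'a"
    and x :: 'a
  assumes "nonassoc_algebra scale amult"
    and "finite_dimensional scale"
    and "anticommutative amult"
    and "group G"
    and "finite (carrier G)"
    and "algebra_action scale amult G act"
    and "CB_element amult x"
  shows "\<forall>g \<in> carrier G. CB_element amult (act g x)"
  using algebra_action.CB_element_act[OF assms(6)] assms(7) by blast

end
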